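(* Let $\beta>0$, $T>0$, and let $a_{22},a_{32},a_{33},a_{42},a_{43},a_{44}$ be real numbers satisfying $$2a_{22}>|a_{32}-a_{22}|+|a_{42}-a_{32}|,\qquad 2a_{33}>|a_{32}-a_{22}|+|a_{43}-a_{33}|,\qquad 2a_{44}>|a_{42}-a_{32}|+|a_{43}-a_{33}|.$$ Let $\boldsymbol m_n$, $n\ge0$, be generated, for a time step $k>0$ and mesh size $h=1/N$, by the scheme $$\tilde{\boldsymbol m}_1=\boldsymbol m_n,\qquad \tilde{\boldsymbol m}_2=\tilde{\boldsymbol m}_1+k\,a_{22}\beta\Delta_h\tilde{\boldsymbol m}_2,\qquad \tilde{\boldsymbol m}_3=\tilde{\boldsymbol m}_1+k\big(a_{32}\beta\Delta_h\tilde{\boldsymbol m}_2+a_{33}\beta\Delta_h\tilde{\boldsymbol m}_3\big),$$ $$\tilde{\boldsymbol m}_4=\tilde{\boldsymbol m}_1+k\big(a_{42}\beta\Delta_h\tilde{\boldsymbol m}_2+a_{43}\beta\Delta_h\tilde{\boldsymbol m}_3+a_{44}\beta\Delta_h\tilde{\boldsymbol m}_4\big),\qquad \boldsymbol m_{n+1}=\tilde{\boldsymbol m}_4 .$$ Then the numerical solution is bounded in $\ell^\infty(0,T;\ell^2)\cap\ell^2(0,T;H^1_h)$: there is a constant $C>0$, depending only on $\beta$, $T$ and the coefficients $a_{ij}$ (not on $k$ or $h$), such that $$\max_{0\le n\le\lfloor T/k\rfloor}\|\boldsymbol m_n\|_2+\Big(k\sum_{n=1}^{\lfloor T/k\rfloor}\big(\|\boldsymbol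 m_n\|_2^2+\|\nabla_h\boldsymbol m_n\|_2^2\big)\Big)^{1/2}\le C\|\boldsymbol m_0\|_2 .$$
   Context: $\Omega=(0,1)^d$, $d\in\{1,2,3\}$, $h=1/N$; the grid points in each coordinate direction are $(i-\tfrac12)h$, $i=1,\dots,N$, with ghost points $i=0,N+1$. Grid functions are $\mathbb R^3$-valued and satisfy the discrete homogeneous Neumann condition: in each direction the value at index $0$ equals that at index $1$ and the value at index $N+1$ equals that at index $N$ (this applies to $\boldsymbol m_n$ and all stages $\tilde{\boldsymbol m}_j$). $\Delta_h$ is the standard $(2d+1)$-point centered difference Laplacian; $\nabla_h$ is the discrete gradient with entries the one-step differences $(\boldsymbol m_{i+1}-\boldsymbol m_i)/h$ in each coordinate direction, so that $\langle-\Delta_h\boldsymbol f_h,\boldsymbol g_h\rangle=\langle\nabla_h\boldsymbol f_h,\nabla_h\boldsymbol g_h\rangle$. $\langle\boldsymbol f_h,\boldsymbol g_h\rangle=h^d\sum_I\boldsymbol f_I\cdot\boldsymbol g_I$, $\|\boldsymbol f_h\|_2=\langle\boldsymbol f_h,\boldsymbol f_h\rangle^{1/2}$ (analogously for $\nabla_h\boldsymbol f_h$), and $\|\boldsymbol f_h\|_{H^1}^2=\|\boldsymbol f_h\|_2^2+\|\nabla_h\boldsymbol f_h\|_2^2$. *)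

theory Defs
  imports "HOL-Analysis.Analysis"
begin

text \<open>
  The grid on \<open>(0,1)^d\<close> is represented by multi-indices \<open>I\<close> in \<open>{1..N}^d\<close>; the index \<open>I\<close> stands
  for the node with coordinates \<open>(I j - 1/2) h\<close>, \<open>h = 1/N\<close>. Directions are numbered \<open>0, ..., d-1\<close>,
  and multi-indices are \<open>undefined\<close> outside \<open>{..<d}\<close>. The dimension is a number rather than a type, so
  that a constant can be chosen uniformly in it. Grid functions are total functions, of which only
  the values at nodes and at ghost points adjacent to a node are ever used.
\<close>

type_synonym multi_index = "nat \<Rightarrow> nat"

type_synonym grid_fun = "multi_index \<Rightarrow> real ^ 3"

definition mesh_size :: "nat \<Rightarrow> real" where
  "mesh_size N = 1 / real N"

definition grid :: "nat \<Rightarrow> nat \<Rightarrow> multi_index set" where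
  "grid d N = (\<Pi>\<^sub>E j\<in>{..<d}. {1..N})"

text \<open>
  Ghost points with two or more ghost coordinates are left unconstrained: no difference operator
  below uses them.
\<close>

definition neumann :: "nat \<Rightarrow> nat \<Rightarrow> grid_fun \<Rightarrow> bool" where
  "neumann d N f \<longleftrightarrow>
     (\<forall>I\<in>grid d N. \<forall>j<d. f (I(j := 0)) = f (I(j := 1)) \<and> f (I(j := N + 1)) = f (I(j := N)))"

definition disc_laplacian :: "nat \<Rightarrow> nat \<Rightarrow> grid_fun \<Rightarrow> grid_fun" where
  "disc_laplacian d N f I =
     (\<Sum>j<d. (f (I(j := I j + 1)) - 2 *\<^sub>R f I + f (I(j := I j - 1))) /\<^sub>R (mesh_size N)\<^sup>2)"

definition disc_gradient :: "nat \<Rightarrow> grid_fun \<Rightarrow> nat \<Rightarrow> grid_fun" where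
  "disc_gradient N f j I = (f (I(j := I j + 1)) - f I) /\<^sub>R mesh_size N"

definition disc_inner :: "nat \<Rightarrow> nat \<Rightarrow> grid_fun \<Rightarrow> grid_fun \<Rightarrow> real" where
  "disc_inner d N f g = mesh_size N ^ d * (\<Sum>I\<in>grid d N. f I \<bullet> g I)"

definition disc_norm :: "nat \<Rightarrow> nat \<Rightarrow> grid_fun \<Rightarrow> real" where
  "disc_norm d N f = sqrt (disc_inner d N f f)"

text \<open>
  The same inner product and norm for fields with one grid function per direction, such as
  discrete gradients. In direction \<open>j\<close> the difference at \<open>I j = N\<close> reaches a ghost point, so it
  vanishes under the Neumann condition.
\<close>

definition disc_inner_field ::
    "nat \<Rightarrow> nat \<Rightarrow> (nat \<Rightarrow> grid_fun) \<Rightarrow> (nat \<Rightarrow> grid_fun) \<Rightarrow> real" where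
  "disc_inner_field d N F G = mesh_size N ^ d * (\<Sum>I\<in>grid d N. \<Sum>j<d. F j I \<bullet> G j I)"

definition disc_norm_field :: "nat \<Rightarrow> nat \<Rightarrow> (nat \<Rightarrow> grid_fun) \<Rightarrow> real" where
  "disc_norm_field d N F = sqrt (disc_inner_field d N F F)"

definition rk_step ::
    "real \<Rightarrow> real \<Rightarrow> real \<Rightarrow> real \<Rightarrow> real \<Rightarrow> real \<Rightarrow> real \<Rightarrow> real \<Rightarrow> nat \<Rightarrow> nat
      \<Rightarrow> grid_fun \<Rightarrow> grid_fun \<Rightarrow> bool" where
  "rk_step \<beta> a22 a32 a33 a42 a43 a44 k d N u v \<longleftrightarrow>
     (\<exists>m1 m2 m3 m4.
        neumann d N m1 \<and> neumann d N m2 \<and> neumann d N m3 \<and> neumann d N m4 \<and>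
        (\<forall>I\<in>grid d N.
           m1 I = u I \<and>
           m2 I = m1 I + k *\<^sub>R ((a22 * \<beta>) *\<^sub>R disc_laplacian d N m2 I) \<and>
           m3 I = m1 I + k *\<^sub>R ((a32 * \<beta>) *\<^sub>R disc_laplacian d N m2 I
                                + (a33 * \<beta>) *\<^sub>R disc_laplacian d N m3 I) \<and>
           m4 I = m1 I + k *\<^sub>R ((a42 * \<beta>) *\<^sub>R disc_laplacian d N m2 I
                                + (a43 * \<beta>) *\<^sub>R disc_laplacian d N m3 I
                                + (a44 * \<beta>) *\<^sub>R disc_laplacian d N m4 I) \<and>
           v I = m4 I))"

definition rk_solution ::
    "real \<Rightarrow> real \<Rightarrow> real \<Rightarrow> real \<Rightarrow> real \<Rightarrow> real \<Rightarrow> real \<Rightarrow> real \<Rightarrow> nat \<Rightarrow> nat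
      \<Rightarrow> (nat \<Rightarrow> grid_fun) \<Rightarrow> bool" where
  "rk_solution \<beta> a22 a32 a33 a42 a43 a44 k d N m \<longleftrightarrow>
     (\<forall>n. neumann d N (m n) \<and> rk_step \<beta> a22 a32 a33 a42 a43 a44 k d N (m n) (m (Suc n)))"

end

theory Submission
  imports Defs
begin

text \<open>
  Subtracting consecutive stages turns each stage into an implicit step from the previous one.
  Testing the step into stage \<open>i\<close> with that stage, summing by parts and adding up, the
  square norms telescope, and the mixed gradient products are absorbed by Young's inequality, which
  is what the three diagonal dominance conditions are for. What survives is
  \<open>\<parallel>m (n+1)\<parallel>\<^sup>2 + k \<beta> \<delta> \<parallel>\<nabla> m (n+1)\<parallel>\<^sup>2 \<le> \<parallel>m n\<parallel>\<^sup>2\<close> with the slack \<open>\<delta> > 0\<close> of the third condition.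
\<close>

section \<open>Index shifts on the grid and summation by parts\<close>

lemma finite_grid [simp]: "finite (grid d N)"
  unfolding grid_def by (intro finite_PiE) auto

lemma grid_upd: "I \<in> grid d N \<Longrightarrow> j < d \<Longrightarrow> 1 \<le> i \<Longrightarrow> i \<le> N \<Longrightarrow> I(j := i) \<in> grid d N"
  unfolding grid_def PiE_def Pi_def extensional_def by auto

lemma gridD: "I \<in> grid d N \<Longrightarrow> j < d \<Longrightarrow> 1 \<le> I j \<and> I j \<le> N"
  unfolding grid_def PiE_def Pi_def by auto

text \<open>Shifting by one in direction \<open>j\<close> is a bijection from the nodes with
  \<open>I j \<noteq> N\<close> onto those with \<open>I j \<noteq> 1\<close>. The two unmatched
  layers contribute zero by \<open>hi\<close> and \<open>lo\<close>.\<close>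

lemma sum_grid_shift:
  fixes P :: "multi_index \<Rightarrow> real"
  assumes "j < d"
    and lo: "\<And>I. I \<in> grid d N \<Longrightarrow> P (I(j := 1)) = 0"
    and hi: "\<And>I. I \<in> grid d N \<Longrightarrow> P (I(j := N + 1)) = 0"
  shows "(\<Sum>I\<in>grid d N. P (I(j := I j + 1))) = (\<Sum>I\<in>grid d N. P I)"
proof (rule sum.reindex_bij_witness_not_neutral
    [where S' = "{I \<in> grid d N. I j = N}" and T' = "{I \<in> grid d N. I j = 1}"
       and i = "\<lambda>I. I(j := I j - 1)" and j = "\<lambda>I. I(j := I j + 1)"])
  fix I
  assume I: "I \<in> grid d N - {I \<in> grid d N. I j = N}"
  then show "I(j := I j + 1) \<in> grid d N - {I \<in> grid d N. I j = 1}"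
    using gridD[of I d N j] \<open>j < d\<close> by (auto intro!: grid_upd)
next
  fix I
  assume I: "I \<in> grid d N - {I \<in> grid d N. I j = 1}"
  then have "1 < I j"
    using gridD[of I d N j] \<open>j < d\<close> by auto
  then show "I(j := I j - 1) \<in> grid d N - {I \<in> grid d N. I j = N}"
    and "(I(j := I j - 1))(j := (I(j := I j - 1)) j + 1) = I"
    using I gridD[of I d N j] \<open>j < d\<close> by (auto intro!: grid_upd)
next
  fix I
  assume "I \<in> {I \<in> grid d N. I j = N}"
  then show "P (I(j := I j + 1)) = 0"
    using hi[of I] by auto
next
  fix I
  assume "I \<in> {I \<in> grid d N. I j = 1}"
  then show "P I = 0"
    using lo[of I] by (auto simp: fun_upd_idem)
qed auto

lemma sum_by_parts_direction:
  assumes "j < d" and "neumann d N f"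
  shows "(\<Sum>I\<in>grid d N. (f (I(j := I j + 1)) - 2 *\<^sub>R f I + f (I(j := I j - 1))) \<bullet> g I)
       = - (\<Sum>I\<in>grid d N. (f (I(j := I j + 1)) - f I) \<bullet> (g (I(j := I j + 1)) - g I))"
proof -
  \<comment> \<open>The backward difference of \<open>f\<close> paired with \<open>g\<close>. The
    Neumann condition makes it vanish at indices \<open>1\<close> and \<open>N + 1\<close>, so it
    may be shifted into a forward difference paired with the shifted \<open>g\<close>.\<close>
  define P where "P I = (f I - f (I(j := I j - 1))) \<bullet> g I" for I
  have shift: "(\<Sum>I\<in>grid d N. P (I(j := I j + 1))) = (\<Sum>I\<in>grid d N. P I)"
    using assms by (intro sum_grid_shift) (auto simp: P_def neumann_def)
  have "(\<Sum>I\<in>grid d N. (f (I(j := I j + 1)) - 2 *\<^sub>R f I + f (I(j := I j - 1))) \<bullet> g I)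
      = (\<Sum>I\<in>grid d N. (f (I(j := I j + 1)) - f I) \<bullet> g I) - (\<Sum>I\<in>grid d N. P I)"
    unfolding sum_subtractf[symmetric]
    by (rule sum.cong) (auto simp: P_def inner_simps)
  also have "\<dots> = - (\<Sum>I\<in>grid d N. (f (I(j := I j + 1)) - f I) \<bullet> (g (I(j := I j + 1)) - g I))"
    unfolding shift[symmetric] sum_subtractf[symmetric] sum_negf[symmetric]
    by (rule sum.cong) (auto simp: P_def inner_simps)
  finally show ?thesis .
qed

text \<open>Summation by parts in each direction, added up; the factor \<open>1 / h^2\<close> of the
  Laplacian splits into one \<open>1 / h\<close> for each gradient.\<close>

lemma disc_green:
  assumes "neumann d N f"
  shows "disc_inner d N (disc_laplacian d N f) g
       = - disc_inner_field d N (disc_gradient N f) (disc_gradient N g)"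
proof -
  let ?c = "inverse ((mesh_size N)\<^sup>2)"
  have "(\<Sum>I\<in>grid d N. disc_laplacian d N f I \<bullet> g I)
      = (\<Sum>j<d. ?c * (\<Sum>I\<in>grid d N. (f (I(j := I j + 1)) - 2 *\<^sub>R f I + f (I(j := I j - 1))) \<bullet> g I))"
    unfolding disc_laplacian_def inner_sum_left sum_distrib_left
    by (subst sum.swap) simp
  also have "\<dots> = (\<Sum>j<d. ?c *
      - (\<Sum>I\<in>grid d N. (f (I(j := I j + 1)) - f I) \<bullet> (g (I(j := I j + 1)) - g I)))"
    using assms by (intro sum.cong refl) (simp only: sum_by_parts_direction lessThan_iff)
  also have "\<dots> = - (\<Sum>I\<in>grid d N. \<Sum>j<d. disc_gradient N f j I \<bullet> disc_gradient N g j I)"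
    unfolding disc_gradient_def sum_negf[symmetric] sum_distrib_left
    by (subst sum.swap) (simp add: power2_eq_square sum_negf sum_distrib_left mult.assoc)
  finally show ?thesis
    by (simp add: disc_inner_def disc_inner_field_def)
qed

section \<open>Discrete norms, Young's inequality and energy estimates\<close>

lemma mesh_size_nonneg: "0 \<le> mesh_size N"
  by (simp add: mesh_size_def)

lemma disc_norm_sq: "(disc_norm d N f)\<^sup>2 = disc_inner d N f f"
  unfolding disc_norm_def disc_inner_def
  by (intro real_sqrt_pow2 mult_nonneg_nonneg sum_nonneg) (auto simp: mesh_size_nonneg)

lemma disc_norm_nonneg: "0 \<le> disc_norm d N f"
  unfolding disc_norm_def disc_inner_def
  by (intro real_sqrt_ge_zero mult_nonneg_nonneg sum_nonneg) (auto simp: mesh_size_nonneg)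

lemma disc_inner_field_nonneg: "0 \<le> disc_inner_field d N F F"
  unfolding disc_inner_field_def
  by (intro mult_nonneg_nonneg sum_nonneg) (auto simp: mesh_size_nonneg)

lemma disc_norm_field_sq: "(disc_norm_field d N F)\<^sup>2 = disc_inner_field d N F F"
  unfolding disc_norm_field_def by (simp add: disc_inner_field_nonneg)

text \<open>The equal weights matter: they make the absolute values of the off-diagonal coefficients
  appear exactly as in the dominance conditions.\<close>

lemma disc_inner_field_young:
  "2 * \<bar>disc_inner_field d N F G\<bar> \<le> disc_inner_field d N F F + disc_inner_field d N G G"
proof -
  have pt: "2 * \<bar>x \<bullet> y\<bar> \<le> x \<bullet> x + y \<bullet> y" for x y :: "real ^ 3"
    using inner_ge_zero[of "x - y"] inner_ge_zero[of "x + y"]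
    by (simp add: inner_simps inner_commute)
  have "2 * \<bar>\<Sum>I\<in>grid d N. \<Sum>j<d. F j I \<bullet> G j I\<bar> \<le> (\<Sum>I\<in>grid d N. \<Sum>j<d. 2 * \<bar>F j I \<bullet> G j I\<bar>)"
    unfolding sum_distrib_left[symmetric]
    by (intro mult_left_mono order.trans[OF sum_abs] sum_mono) auto
  also have "\<dots> \<le> (\<Sum>I\<in>grid d N. \<Sum>j<d. F j I \<bullet> F j I + G j I \<bullet> G j I)"
    by (intro sum_mono pt)
  finally have "mesh_size N ^ d * (2 * \<bar>\<Sum>I\<in>grid d N. \<Sum>j<d. F j I \<bullet> G j I\<bar>)
      \<le> mesh_size N ^ d * (\<Sum>I\<in>grid d N. \<Sum>j<d. F j I \<bullet> F j I + G j I \<bullet> G j I)"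
    by (intro mult_left_mono) (auto simp: mesh_size_nonneg)
  then show ?thesis
    by (simp add: disc_inner_field_def abs_mult mesh_size_nonneg sum.distrib distrib_left mult.left_commute)
qed

lemma disc_inner_cong:
  "(\<And>I. I \<in> grid d N \<Longrightarrow> f I = g I) \<Longrightarrow> disc_inner d N f f = disc_inner d N g g"
  unfolding disc_inner_def by simp

text \<open>The scheme identifies functions only at nodes, while the forward difference at
  \<open>I j = N\<close> reads a ghost value. The Neumann condition reduces that value to the nodal
  one.\<close>

lemma disc_gradient_cong:
  assumes "neumann d N f" and "neumann d N g" and eq: "\<And>I. I \<in> grid d N \<Longrightarrow> f I = g I"
    and "I \<in> grid d N" and "j < d"
  shows "disc_gradient N f j I = disc_gradient N g j I"
proof -
  have "f (I(j := I j + 1)) = g (I(j := I j + 1))"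
  proof (cases "I j = N")
    case True
    have "I(j := N) = I" using True by auto
    then show ?thesis
      using assms True by (auto simp: neumann_def)
  next
    case False
    then show ?thesis
      using gridD[OF assms(4,5)] assms(4,5) by (intro eq grid_upd) auto
  qed
  then show ?thesis
    using assms by (simp add: disc_gradient_def)
qed

lemma disc_inner_gradient_cong:
  assumes "neumann d N f" and "neumann d N g" and "\<And>I. I \<in> grid d N \<Longrightarrow> f I = g I"
  shows "disc_inner_field d N (disc_gradient N f) (disc_gradient N f)
       = disc_inner_field d N (disc_gradient N g) (disc_gradient N g)"
  unfolding disc_inner_field_def using disc_gradient_cong[OF assms] by simp

text \<open>Common form of all stage differences, with absent Laplacians given coefficient
  \<open>0\<close>. Pairing the step with \<open>v\<close> and using
  \<open>2 u.v \<le> u.u + v.v\<close> at each node gives the square norms;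
  \<open>disc_green\<close> turns the Laplacian terms into gradient products.\<close>

lemma implicit_step_energy:
  fixes x y z :: grid_fun
  assumes nm: "neumann d N x" "neumann d N y" "neumann d N z"
    and step: "\<And>I. I \<in> grid d N \<Longrightarrow> v I = u I + k *\<^sub>R (p *\<^sub>R disc_laplacian d N x I
        + q *\<^sub>R disc_laplacian d N y I + r *\<^sub>R disc_laplacian d N z I)"
  defines "B \<equiv> \<lambda>f g. disc_inner_field d N (disc_gradient N f) (disc_gradient N g)"
  shows "disc_inner d N v v \<le> disc_inner d N u u - 2 * k * (p * B x v + q * B y v + r * B z v)"
proof -
  let ?L = "disc_laplacian d N"
  have "v I \<bullet> v I \<le> u I \<bullet> u I
      + 2 * k * (p * (?L x I \<bullet> v I) + q * (?L y I \<bullet> v I) + r * (?L z I \<bullet> v I))"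
    if "I \<in> grid d N" for I
  proof -
    have "v I \<bullet> v I = u I \<bullet> v I
        + k * (p * (?L x I \<bullet> v I) + q * (?L y I \<bullet> v I) + r * (?L z I \<bullet> v I))"
      by (subst step[OF that]) (simp add: inner_add_left)
    moreover have "2 * (u I \<bullet> v I) \<le> u I \<bullet> u I + v I \<bullet> v I"
      using inner_ge_zero[of "u I - v I"] by (simp add: inner_simps inner_commute)
    ultimately show ?thesis by linarith
  qed
  then have "mesh_size N ^ d * (\<Sum>I\<in>grid d N. v I \<bullet> v I)
      \<le> mesh_size N ^ d * (\<Sum>I\<in>grid d N. u I \<bullet> u I
      + 2 * k * (p * (?L x I \<bullet> v I) + q * (?L y I \<bullet> v I) + r * (?L z I \<bullet> v I)))"
    by (intro mult_left_mono sum_mono) (auto simp: mesh_size_nonneg)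
  then have "disc_inner d N v v \<le> disc_inner d N u u + 2 * k * (p * disc_inner d N (?L x) v
      + q * disc_inner d N (?L y) v + r * disc_inner d N (?L z) v)"
    by (simp add: disc_inner_def sum.distrib sum_distrib_left[symmetric] algebra_simps)
  then show ?thesis
    by (simp add: disc_green nm B_def algebra_simps)
qed

lemma rk_step_energy:
  fixes \<beta> a22 a32 a33 a42 a43 a44 k :: real
  assumes "\<beta> > 0" and "k > 0"
    and dom2: "2 * a22 \<ge> \<bar>a32 - a22\<bar> + \<bar>a42 - a32\<bar>"
    and dom3: "2 * a33 \<ge> \<bar>a32 - a22\<bar> + \<bar>a43 - a33\<bar>"
    and "neumann d N v" and "rk_step \<beta> a22 a32 a33 a42 a43 a44 k d N u v"
  shows "(disc_norm d N v)\<^sup>2 + k * (\<beta> * (2 * a44 - \<bar>a42 - a32\<bar> - \<bar>a43 - a33\<bar>)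
             * (disc_norm_field d N (disc_gradient N v))\<^sup>2)
       \<le> (disc_norm d N u)\<^sup>2"
proof -
  let ?L = "disc_laplacian d N"
  define B where "B f g = disc_inner_field d N (disc_gradient N f) (disc_gradient N g)" for f g
  obtain m1 m2 m3 m4 where nm: "neumann d N m2" "neumann d N m3" "neumann d N m4"
    and eq: "\<And>I. I \<in> grid d N \<Longrightarrow> m1 I = u I"
      "\<And>I. I \<in> grid d N \<Longrightarrow> m2 I = m1 I + k *\<^sub>R ((a22 * \<beta>) *\<^sub>R ?L m2 I)"
      "\<And>I. I \<in> grid d N \<Longrightarrow> m3 I = m1 I + k *\<^sub>R ((a32 * \<beta>) *\<^sub>R ?L m2 I + (a33 * \<beta>) *\<^sub>R ?L m3 I)"
      "\<And>I. I \<in> grid d N \<Longrightarrow> m4 I = m1 I + k *\<^sub>R ((a42 * \<beta>) *\<^sub>R ?L m2 I + (a43 * \<beta>) *\<^sub>R ?L m3 I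
         + (a44 * \<beta>) *\<^sub>R ?L m4 I)"
      "\<And>I. I \<in> grid d N \<Longrightarrow> v I = m4 I"
    using assms(6) unfolding rk_step_def by blast
  have e2: "disc_inner d N m2 m2 \<le> disc_inner d N m1 m1
      - 2 * k * (a22 * \<beta> * B m2 m2 + 0 * B m3 m2 + 0 * B m4 m2)"
    unfolding B_def by (rule implicit_step_energy[OF nm]) (subst eq(2), auto)
  \<comment> \<open>Inserting the equations of both stages cancels \<open>m1\<close>, so the
    coefficients become differences such as \<open>a32 - a22\<close>.\<close>
  have e3: "disc_inner d N m3 m3 \<le> disc_inner d N m2 m2
      - 2 * k * ((a32 - a22) * \<beta> * B m2 m3 + a33 * \<beta> * B m3 m3 + 0 * B m4 m3)"
    unfolding B_def
    by (rule implicit_step_energy[OF nm]) (subst eq(2), simp, subst eq(3), simp_all add: algebra_simps)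
  have e4: "disc_inner d N m4 m4 \<le> disc_inner d N m3 m3
      - 2 * k * ((a42 - a32) * \<beta> * B m2 m4 + (a43 - a33) * \<beta> * B m3 m4 + a44 * \<beta> * B m4 m4)"
    unfolding B_def
    by (rule implicit_step_energy[OF nm]) (subst eq(3), simp, subst eq(4), simp_all add: algebra_simps)
  have young: "- (2 * (c * B f g)) \<le> \<bar>c\<bar> * (B f f + B g g)" for c f g
  proof -
    have "- (2 * (c * B f g)) \<le> \<bar>c\<bar> * (2 * \<bar>B f g\<bar>)"
      using abs_ge_minus_self[of "c * B f g"] by (simp add: abs_mult)
    also have "\<dots> \<le> \<bar>c\<bar> * (B f f + B g g)"
      unfolding B_def by (intro mult_left_mono disc_inner_field_young) auto
    finally show ?thesis .
  qed
  \<comment> \<open>Each of \<open>m2\<close>, \<open>m3\<close>, \<open>m4\<close> occurs in two of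
    the three mixed products, so Young's inequality charges its diagonal term twice. The remainders
    for \<open>m2\<close> and \<open>m3\<close> are nonnegative and are discarded; the one for
    \<open>m4\<close> is kept.\<close>
  have nn: "0 \<le> (2 * a22 - \<bar>a32 - a22\<bar> - \<bar>a42 - a32\<bar>) * B m2 m2"
    "0 \<le> (2 * a33 - \<bar>a32 - a22\<bar> - \<bar>a43 - a33\<bar>) * B m3 m3"
    using dom2 dom3 by (auto intro!: mult_nonneg_nonneg simp: B_def disc_inner_field_nonneg)
  have "(2 * a44 - \<bar>a42 - a32\<bar> - \<bar>a43 - a33\<bar>) * B m4 m4
      \<le> 2 * (a22 * B m2 m2 + ((a32 - a22) * B m2 m3 + a33 * B m3 m3)
          + ((a42 - a32) * B m2 m4 + (a43 - a33) * B m3 m4 + a44 * B m4 m4))" (is "?l \<le> 2 * ?s")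
    using young[of "a32 - a22" m2 m3] young[of "a42 - a32" m2 m4] young[of "a43 - a33" m3 m4] nn
    by (simp only: left_diff_distrib distrib_left)
  then have "k * \<beta> * ?l \<le> k * \<beta> * (2 * ?s)"
    using assms(1,2) by (intro mult_left_mono) auto
  moreover have "disc_inner d N m4 m4 \<le> disc_inner d N m1 m1 - k * \<beta> * (2 * ?s)"
    using e2 e3 e4 by (simp add: algebra_simps)
  ultimately have "disc_inner d N m4 m4 + k * \<beta> * ?l \<le> disc_inner d N m1 m1"
    by linarith
  moreover have "disc_inner d N m1 m1 = disc_inner d N u u" "disc_inner d N m4 m4 = disc_inner d N v v"
    using eq by (auto intro!: disc_inner_cong)
  moreover have "B m4 m4 = B v v"
    unfolding B_def using eq nm assms(5) by (intro disc_inner_gradient_cong) auto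
  ultimately show ?thesis
    by (simp add: disc_norm_sq disc_norm_field_sq B_def mult.assoc)
qed

section \<open>From one time step to the whole time interval\<close>

theorem mainTheorem2:
  fixes \<beta> T a22 a32 a33 a42 a43 a44 :: real
  assumes "\<beta> > 0" and "T > 0"
    and "2 * a22 > \<bar>a32 - a22\<bar> + \<bar>a42 - a32\<bar>"
    and "2 * a33 > \<bar>a32 - a22\<bar> + \<bar>a43 - a33\<bar>"
    and "2 * a44 > \<bar>a42 - a32\<bar> + \<bar>a43 - a33\<bar>"
  shows "\<exists>C>0. \<forall>d\<in>{1,2,3::nat}. \<forall>N\<ge>1. \<forall>k>0. \<forall>m :: nat \<Rightarrow> grid_fun.
           rk_solution \<beta> a22 a32 a33 a42 a43 a44 k d N m \<longrightarrow>
           Max ((\<lambda>n. disc_norm d N (m n)) ` {0..nat \<lfloor>T / k\<rfloor>})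
             + sqrt (k * (\<Sum>n = 1..nat \<lfloor>T / k\<rfloor>. (disc_norm d N (m n))\<^sup>2
                            + (disc_norm_field d N (disc_gradient N (m n)))\<^sup>2))
           \<le> C * disc_norm d N (m 0)"
proof -
  define c where "c = \<beta> * (2 * a44 - \<bar>a42 - a32\<bar> - \<bar>a43 - a33\<bar>)"
  \<comment> \<open>The \<open>1\<close> pays for the maximum, \<open>T\<close> for the summed
    square norms and \<open>1 / c\<close> for the summed gradients. None of them involves
    \<open>d\<close>, \<open>N\<close>, \<open>k\<close> or \<open>m\<close>.\<close>
  define C where "C = 1 + sqrt (T + 1 / c)"
  have c: "c > 0"
    using assms by (simp add: c_def)
  have C: "C > 0"
    using c \<open>T > 0\<close> by (simp add: C_def add_pos_nonneg)
  moreover have "Max ((\<lambda>n. disc_norm d N (m n)) ` {0..nat \<lfloor>T / k\<rfloor>})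
             + sqrt (k * (\<Sum>n = 1..nat \<lfloor>T / k\<rfloor>. (disc_norm d N (m n))\<^sup>2
                            + (disc_norm_field d N (disc_gradient N (m n)))\<^sup>2))
           \<le> C * disc_norm d N (m 0)"
    if k: "k > 0" and sol: "rk_solution \<beta> a22 a32 a33 a42 a43 a44 k d N m" for d N k m
  proof -
    define a where "a n = disc_norm d N (m n)" for n
    define g where "g n = (disc_norm_field d N (disc_gradient N (m n)))\<^sup>2" for n
    define M where "M = nat \<lfloor>T / k\<rfloor>"
    have a0: "0 \<le> a n" and g0: "0 \<le> g n" for n
      by (simp_all add: a_def g_def disc_norm_nonneg)
    have step: "(a (Suc n))\<^sup>2 + k * (c * g (Suc n)) \<le> (a n)\<^sup>2" for n
      unfolding a_def g_def c_def
      using sol assms k by (intro rk_step_energy) (auto simp: rk_solution_def)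
    \<comment> \<open>Each step controls the gradient at its new time level, so the telescoped sum
      starts at \<open>1\<close>, as in the claim.\<close>
    have energy: "(a n)\<^sup>2 + c * (k * (\<Sum>i = 1..n. g i)) \<le> (a 0)\<^sup>2" for n
    proof (induction n)
      case (Suc n)
      then show ?case
        using step[of n] by (simp add: algebra_simps)
    qed simp
    have a_sq: "(a n)\<^sup>2 \<le> (a 0)\<^sup>2" for n
    proof -
      have "0 \<le> c * (k * (\<Sum>i = 1..n. g i))"
        using c k g0 by (intro mult_nonneg_nonneg sum_nonneg) auto
      then show ?thesis
        using energy[of n] by linarith
    qed
    then have a_le: "a n \<le> a 0" for n
      using a0 power2_le_imp_le by blast
    \<comment> \<open>Rounding \<open>T / k\<close> down keeps the total time within
      \<open>T\<close>, which makes the bound on the summed square norms independent of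
      \<open>k\<close>.\<close>
    have Mk: "k * real M \<le> T"
    proof -
      have "real M \<le> T / k"
        using k \<open>T > 0\<close> by (simp add: M_def)
      then show ?thesis
        using k by (simp add: field_simps)
    qed
    have "k * (\<Sum>n = 1..M. (a n)\<^sup>2) \<le> k * (\<Sum>n = 1..M. (a 0)\<^sup>2)"
      using k a_sq by (intro mult_left_mono sum_mono) auto
    also have "\<dots> \<le> T * (a 0)\<^sup>2"
      using mult_right_mono[OF Mk, of "(a 0)\<^sup>2"] by (simp add: mult.assoc)
    finally have sum_a: "k * (\<Sum>n = 1..M. (a n)\<^sup>2) \<le> T * (a 0)\<^sup>2" .
    have "c * (k * (\<Sum>n = 1..M. g n)) \<le> (a 0)\<^sup>2"
      using energy[of M] zero_le_power2[of "a M"] by linarith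
    then have sum_g: "k * (\<Sum>n = 1..M. g n) \<le> 1 / c * (a 0)\<^sup>2"
      using c by (simp add: field_simps)
    have "k * (\<Sum>n = 1..M. (a n)\<^sup>2 + g n) \<le> (T + 1 / c) * (a 0)\<^sup>2"
      using sum_a sum_g by (simp add: sum.distrib distrib_left distrib_right)
    then have "sqrt (k * (\<Sum>n = 1..M. (a n)\<^sup>2 + g n)) \<le> sqrt (T + 1 / c) * a 0"
      using a0[of 0] real_sqrt_le_mono by (fastforce simp: real_sqrt_mult)
    moreover have "Max (a ` {0..M}) \<le> a 0"
      by (rule Max.boundedI) (auto intro: a_le)
    ultimately have "Max (a ` {0..M}) + sqrt (k * (\<Sum>n = 1..M. (a n)\<^sup>2 + g n)) \<le> C * a 0"
      unfolding C_def distrib_right by linarith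
    then show ?thesis
      unfolding a_def g_def M_def .
  qed
  ultimately show ?thesis
    by blast
qed

end
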